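(* For all $k\in\mathbb{N}$ and all integers $m\ge 2^k$, $$\mu(2^{k+1}-1,m)=\mu^*(2^{k+1}-1,2^k)=2^k.$$
   Context: $\mathbb{F}_2$ is the field with two elements. For $u\in\mathbb{F}_2^n$, $|u|$ is the number of entries of $u$ equal to $1$. For an $n\times n$ matrix $W$ over $\mathbb{F}_2$, $M(W,0)=\max\{|Wx| : x\in\mathbb{F}_2^n\}$. For $n,m\ge 1$, $A(n,m)$ is the set of $n\times n$ matrices over $\mathbb{F}_2$ with all diagonal entries $1$ and every column containing at most $m$ ones; for $n\ge m$, $A^*(n,m)$ is the subset of those in which every column contains exactly $m$ ones. $\mu(n,m)=\min\{M(W,0):W\in A(n,m)\}$ and $\mu^*(n,m)=\min\{M(W,0):W\in A^*(n,m)\}$. *)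

theory Defs
  imports "Jordan_Normal_Form.Matrix" "HOL-Library.Z2"
begin

text \<open>The field with two elements is the type \<^typ>\<open>bit\<close>. Vectors and matrices are the
  dimension-carrying ones of Jordan_Normal_Form, with indices starting at 0.\<close>

definition weight :: "bit vec \<Rightarrow> nat" where
  "weight u = card {i. i < dim_vec u \<and> u $ i = 1}"

text \<open>This is the quantity $M(W,0)$.\<close>

definition max_weight :: "bit mat \<Rightarrow> nat" where
  "max_weight W = Max {weight (W *\<^sub>v x) | x. x \<in> carrier_vec (dim_col W)}"

definition A :: "nat \<Rightarrow> nat \<Rightarrow> bit mat set" where
  "A n m = {W \<in> carrier_mat n n.
     (\<forall>i<n. W $$ (i, i) = 1) \<and> (\<forall>j<n. weight (col W j) \<le> m)}"

definition A_star :: "nat \<Rightarrow> nat \<Rightarrow> bit mat set" where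
  "A_star n m = {W \<in> A n m. \<forall>j<n. weight (col W j) = m}"

text \<open>All sets of matrices and vectors above are finite, so the maximum and the minima are genuine
  whenever the sets are nonempty: \<^term>\<open>A n m\<close> is for \<open>m \<ge> 1\<close>, \<^term>\<open>A_star n m\<close> for
  \<open>n \<ge> m \<ge> 1\<close>.\<close>

definition mu :: "nat \<Rightarrow> nat \<Rightarrow> nat" where
  "mu n m = Min (max_weight ` A n m)"

definition mu_star :: "nat \<Rightarrow> nat \<Rightarrow> nat" where
  "mu_star n m = Min (max_weight ` A_star n m)"

end

theory Submission
  imports Defs
begin

text \<open>Lower bound: every row of \<open>W\<close> is nonzero, so each entry of \<open>W x\<close> equals 1 for exactly half of
  all \<open>x\<close>; the average of \<open>|W x|\<close> is therefore \<open>n / 2\<close>, and \<open>n = 2 ^ (k + 1) - 1\<close> is odd. Upper bound: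
  take the columns of \<open>W\<close> from the simplex code, all of whose nonzero words have weight \<open>2 ^ k\<close>.
  The word of the \<open>t\<close>-th coordinate functional has entry 1 at the position indexed by \<open>v\<close> iff
  \<open>v\<close> has bit \<open>t\<close>, so the diagonal condition only asks that column \<open>v\<close> uses a bit that is set in \<open>v\<close>.\<close>

text \<open>\<open>f\<close> pairs the elements satisfying \<open>P\<close> with those violating it.
  Used twice: for translation by a unit vector and for flipping one binary digit.\<close>

lemma card_involution_half:
  assumes "finite X" and "\<And>x. x \<in> X \<Longrightarrow> f x \<in> X" and "\<And>x. x \<in> X \<Longrightarrow> f (f x) = x"
    and "\<And>x. x \<in> X \<Longrightarrow> P (f x) \<longleftrightarrow> \<not> P x"
  shows "2 * card {x \<in> X. P x} = card X"
proof -
  have "bij_betw f {x \<in> X. P x} {x \<in> X. \<not> P x}"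
    by (rule bij_betw_byWitness[where f' = f]) (use assms in auto)
  then have "card {x \<in> X. P x} = card {x \<in> X. \<not> P x}"
    by (rule bij_betw_same_card)
  moreover have "card X = card {x \<in> X. P x} + card {x \<in> X. \<not> P x}"
    by (subst card_Un_disjoint[symmetric])
      (use assms(1) in \<open>auto intro!: arg_cong[where f = card]\<close>)
  ultimately show ?thesis by simp
qed

lemma weight_le: "weight u \<le> dim_vec u"
  unfolding weight_def by (rule order_trans[OF card_mono[of "{..<dim_vec u}"]]) auto

lemma finite_weights: "finite {weight (W *\<^sub>v x) | x. x \<in> carrier_vec (dim_col W)}"
  by (rule finite_subset[of _ "{..dim_row W}"])
    (auto intro: order_trans[OF weight_le])

lemma weight_le_max_weight:
  assumes "x \<in> carrier_vec (dim_col W)"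
  shows "weight (W *\<^sub>v x) \<le> max_weight W"
  unfolding max_weight_def using assms by (intro Max_ge finite_weights) auto

lemma max_weight_leI:
  assumes "\<And>x. x \<in> carrier_vec (dim_col W) \<Longrightarrow> weight (W *\<^sub>v x) \<le> b"
  shows "max_weight W \<le> b"
proof -
  \<comment> \<open>The zero vector makes the set nonempty, as \<open>Max_le_iff\<close>
    requires.\<close>
  have "weight (W *\<^sub>v 0\<^sub>v (dim_col W)) \<in> {weight (W *\<^sub>v x) | x. x \<in> carrier_vec (dim_col W)}"
    by auto
  then show ?thesis
    unfolding max_weight_def using assms
    by (subst Max_le_iff[OF finite_weights]) blast+
qed

lemma max_weight_le_dim_row: "max_weight W \<le> dim_row W"
  by (rule max_weight_leI) (auto intro: order_trans[OF weight_le])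

lemma finite_max_weight_A: "finite (max_weight ` A n m)"
  by (rule finite_subset[of _ "{..n}"])
    (auto simp: A_def intro: order_trans[OF max_weight_le_dim_row])

lemma finite_carrier_vec_bit: "finite (carrier_vec n :: bit vec set)"
proof -
  have bit_UNIV: "(UNIV :: bit set) = {0, 1}"
    by (auto intro: bit.exhaust)
  have "finite {xs. set xs \<subseteq> (UNIV :: bit set) \<and> length xs = n}"
    by (rule finite_lists_length_eq) (simp add: bit_UNIV)
  moreover have "carrier_vec n \<subseteq> vec_of_list ` {xs. set xs \<subseteq> (UNIV :: bit set) \<and> length xs = n}"
  proof
    fix v :: "bit vec"
    assume "v \<in> carrier_vec n"
    then show "v \<in> vec_of_list ` {xs. set xs \<subseteq> UNIV \<and> length xs = n}"
      by (intro image_eqI[of _ _ "list_of_vec v"]) (auto simp: vec_list)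
  qed
  ultimately show ?thesis by (meson finite_imageI finite_subset)
qed

lemma dim_le_twice_max_weight:
  assumes W: "W \<in> carrier_mat n n" and diag: "\<And>i. i < n \<Longrightarrow> W $$ (i, i) = 1"
  shows "n \<le> 2 * max_weight W"
proof -
  let ?X = "carrier_vec n :: bit vec set"
  have half: "2 * card {x \<in> ?X. (W *\<^sub>v x) $ i = 1} = card ?X" if i: "i < n" for i
  \<comment> \<open>Adding the \<open>i\<close>-th unit vector to \<open>x\<close> adds column
    \<open>i\<close> of \<open>W\<close> to \<open>W x\<close>. The diagonal entry 1 in that column
    flips entry \<open>i\<close> of the product.\<close>
  proof (rule card_involution_half[OF finite_carrier_vec_bit, where f = "\<lambda>x. x + unit_vec n i"])
    fix x :: "bit vec"
    assume x: "x \<in> ?X"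
    show "x + unit_vec n i \<in> ?X" using x by simp
    show "x + unit_vec n i + unit_vec n i = x"
      using x by (intro eq_vecI) (auto simp: add.assoc)
    have "(W *\<^sub>v (x + unit_vec n i)) $ i = (W *\<^sub>v x) $ i + row W i \<bullet> unit_vec n i"
      using W i x by (simp add: scalar_prod_add_distrib[where n = n])
    also have "row W i \<bullet> unit_vec n i = 1"
      using W i diag by simp
    finally show "(W *\<^sub>v (x + unit_vec n i)) $ i = 1 \<longleftrightarrow> \<not> (W *\<^sub>v x) $ i = 1"
      by (cases "(W *\<^sub>v x) $ i") auto
  qed
  have "weight (W *\<^sub>v x) = (\<Sum>i<n. of_bool ((W *\<^sub>v x) $ i = 1))" for x
    using W by (simp add: weight_def sum.If_cases lessThan_def Int_def of_bool_def
        del: index_mult_mat_vec)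
  \<comment> \<open>Double counting of the pairs \<open>(x, i)\<close> for which entry
    \<open>i\<close> of \<open>W x\<close> is 1.\<close>
  then have "2 * (\<Sum>x\<in>?X. weight (W *\<^sub>v x))
      = 2 * (\<Sum>x\<in>?X. \<Sum>i<n. of_bool ((W *\<^sub>v x) $ i = 1))"
    by simp
  also have "\<dots> = (\<Sum>i<n. 2 * (\<Sum>x\<in>?X. of_bool ((W *\<^sub>v x) $ i = 1)))"
    by (subst sum.swap) (simp add: sum_distrib_left)
  also have "\<dots> = (\<Sum>i<n. 2 * card {x \<in> ?X. (W *\<^sub>v x) $ i = 1})"
    by (intro sum.cong refl)
      (simp add: of_bool_def sum.If_cases finite_carrier_vec_bit Int_def)
  also have "\<dots> = n * card ?X"
    using half by simp
  finally have "n * card ?X = 2 * (\<Sum>x\<in>?X. weight (W *\<^sub>v x))" ..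
  also have "\<dots> \<le> 2 * (card ?X * max_weight W)"
    using W by (intro mult_left_mono sum_bounded_above[where 'a = nat, simplified]
        weight_le_max_weight) auto
  finally have "n * card ?X \<le> 2 * max_weight W * card ?X"
    by (simp add: ac_simps)
  moreover have "card ?X > 0"
    using finite_carrier_vec_bit zero_carrier_vec by (metis card_gt_0_iff empty_iff)
  ultimately show ?thesis by simp
qed

text \<open>Position \<open>i\<close> of the word carries the nonzero vector of binary digits of \<open>i + 1\<close>.\<close>

definition simplex_word :: "nat \<Rightarrow> (nat \<Rightarrow> bit) \<Rightarrow> bit vec" where
  "simplex_word K c = vec (2 ^ K - 1) (\<lambda>i. \<Sum>t<K. c t * of_bool (bit (i + 1) t))"

text \<open>Flipping digit \<open>s\<close> changes the value of the functional with coefficients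
  \<open>c\<close> by \<open>c s = 1\<close>. So the functional is 1 on exactly half of the
  \<open>2 ^ K\<close> digit vectors.\<close>

lemma weight_simplex_word:
  assumes "s < K" and "c s = 1"
  shows "2 * weight (simplex_word K c) = 2 ^ K"
proof -
  let ?f = "\<lambda>i. \<Sum>t<K. c t * of_bool (bit (i :: nat) t)"
  \<comment> \<open>Position \<open>i\<close> carries the number \<open>i + 1\<close>, hence the
    shift. Adding the number 0, where the functional vanishes, leaves the count unchanged and makes
    the range closed under digit flips.\<close>
  have "Suc ` {i. i < 2 ^ K - 1 \<and> ?f (i + 1) = 1} = {i \<in> {..<2 ^ K}. ?f i = 1}" (is "_ ` ?L = ?R")
  proof (intro equalityI subsetI)
    fix i
    assume i: "i \<in> ?R"
    then have "i \<noteq> 0" by (intro notI) simp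
    with i show "i \<in> Suc ` ?L"
      by (intro image_eqI[of _ _ "i - 1"]) auto
  qed auto
  then have "card ?R = card ?L"
    using card_image[of Suc ?L] by simp
  moreover have "weight (simplex_word K c) = card ?L"
    unfolding weight_def simplex_word_def by (rule arg_cong[where f = card]) auto
  ultimately have "weight (simplex_word K c) = card ?R" by simp
  also have "2 * \<dots> = card {..<2 ^ K :: nat}"
  proof (rule card_involution_half[where f = "flip_bit s"])
    fix i :: nat
    assume i: "i \<in> {..<2 ^ K}"
    \<comment> \<open>As \<open>s < K\<close>, the flip creates no digit at \<open>K\<close> or
      above, so the number stays below \<open>2 ^ K\<close>.\<close>
    then have "take_bit K (flip_bit s i) = flip_bit s i"
      using assms(1) by (simp add: take_bit_flip_bit_eq take_bit_nat_eq_self)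
    then show "flip_bit s i \<in> {..<2 ^ K}"
      using take_bit_nat_less_exp[of K "flip_bit s i"] by simp
    show "flip_bit s (flip_bit s i) = i"
      by (rule bit_eqI) (auto simp: bit_simps)
    have split: "?f j = c s * of_bool (bit j s) + (\<Sum>t\<in>{..<K} - {s}. c t * of_bool (bit j t))" for j
      by (rule sum.remove) (use assms(1) in auto)
    have "(\<Sum>t\<in>{..<K} - {s}. c t * of_bool (bit (flip_bit s i) t))
        = (\<Sum>t\<in>{..<K} - {s}. c t * of_bool (bit i t))"
      by (intro sum.cong refl) (auto simp: bit_simps)
    then have "?f (flip_bit s i) = ?f i + 1"
      unfolding split using assms(2) by (cases "bit i s") (auto simp: bit_simps)
    then show "?f (flip_bit s i) = 1 \<longleftrightarrow> \<not> ?f i = 1"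
      by (cases "?f i") auto
  qed simp
  finally show ?thesis by simp
qed

text \<open>Column \<open>j\<close> is the word of the coordinate functional for the lowest set
  digit of \<open>j + 1\<close>. That the digit is set puts 1 on the diagonal.\<close>

definition simplex_mat :: "nat \<Rightarrow> bit mat" where
  "simplex_mat K = mat (2 ^ K - 1) (2 ^ K - 1)
     (\<lambda>(i, j). of_bool (bit (i + 1) (LEAST t. bit (j + 1) t)))"

lemma bit_LEAST:
  assumes "j \<noteq> (0 :: nat)"
  shows "bit j (LEAST t. bit j t)"
proof -
  have "\<exists>t. bit j t"
    using assms bit_eqI[of j 0] by auto
  then show ?thesis by (rule LeastI_ex)
qed

lemma bit_imp_less_exponent:
  assumes "bit (j :: nat) t" and "j < 2 ^ K"
  shows "t < K"
proof -
  have "bit (take_bit K j) t"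
    using assms by (simp add: take_bit_nat_eq_self)
  then show ?thesis by (simp add: bit_take_bit_iff)
qed

text \<open>Each column is a simplex word, and words are closed under linear combinations.\<close>

lemma simplex_mat_mult_vec:
  assumes x: "x \<in> carrier_vec (2 ^ K - 1)"
  shows "\<exists>c. simplex_mat K *\<^sub>v x = simplex_word K c"
proof -
  let ?n = "2 ^ K - 1 :: nat"
  let ?t = "\<lambda>j. LEAST t. bit (j + 1 :: nat) t"
  \<comment> \<open>Many columns share a digit, so the coefficient of digit \<open>s\<close>
    collects the entries of \<open>x\<close> at all columns using \<open>s\<close>.\<close>
  define c where "c s = (\<Sum>j | j \<in> {..<?n} \<and> ?t j = s. x $ j)" for s
  have t: "?t j < K" if "j < ?n" for j
    by (rule bit_imp_less_exponent[OF bit_LEAST]) (use that in auto)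
  have "simplex_mat K *\<^sub>v x = simplex_word K c"
  proof (rule eq_vecI)
    fix i
    assume "i < dim_vec (simplex_word K c)"
    then have i: "i < ?n" by (simp add: simplex_word_def)
    have "(simplex_mat K *\<^sub>v x) $ i = (\<Sum>j<?n. x $ j * of_bool (bit (i + 1) (?t j)))"
      using i x by (simp add: simplex_mat_def scalar_prod_def lessThan_atLeast0 conj_commute)
    also have "\<dots> = (\<Sum>s<K. \<Sum>j | j \<in> {..<?n} \<and> ?t j = s. x $ j * of_bool (bit (i + 1) (?t j)))"
      by (rule sum.group[symmetric]) (use t in auto)
    also have "\<dots> = (\<Sum>s<K. c s * of_bool (bit (i + 1) s))"
      unfolding c_def sum_distrib_right by (intro sum.cong refl) auto
    finally show "(simplex_mat K *\<^sub>v x) $ i = simplex_word K c $ i"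
      using i by (simp add: simplex_word_def)
  qed (simp add: simplex_mat_def simplex_word_def)
  then show ?thesis by blast
qed

lemma weight_simplex_mat_mult_vec:
  assumes "x \<in> carrier_vec (2 ^ (k + 1) - 1)"
  shows "weight (simplex_mat (k + 1) *\<^sub>v x) = 2 ^ k
    \<or> simplex_mat (k + 1) *\<^sub>v x = 0\<^sub>v (2 ^ (k + 1) - 1)"
proof -
  obtain c where c: "simplex_mat (k + 1) *\<^sub>v x = simplex_word (k + 1) c"
    using simplex_mat_mult_vec[OF assms] by blast
  show ?thesis
  proof (cases "\<exists>s<k + 1. c s = 1")
    case True
    then show ?thesis using weight_simplex_word[of _ "k + 1" c] c by auto
  next
    case False
    then have "c s = 0" if "s < k + 1" for s using that by (cases "c s") auto
    then have "simplex_word (k + 1) c = 0\<^sub>v (2 ^ (k + 1) - 1)"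
      by (intro eq_vecI) (auto simp: simplex_word_def simp del: sum.lessThan_Suc)
    then show ?thesis using c by simp
  qed
qed

lemma simplex_mat_in_A_star: "simplex_mat (k + 1) \<in> A_star (2 ^ (k + 1) - 1) (2 ^ k)"
proof -
  let ?n = "2 ^ (k + 1) - 1 :: nat" and ?W = "simplex_mat (k + 1)"
  have W: "?W \<in> carrier_mat ?n ?n" by (simp add: simplex_mat_def)
  have diag: "?W $$ (j, j) = 1" if "j < ?n" for j
    using that bit_LEAST[of "j + 1"] by (simp add: simplex_mat_def)
  have "weight (col ?W j) = 2 ^ k" if j: "j < ?n" for j
  proof -
    \<comment> \<open>A column is the image of a unit vector, so it has weight \<open>2 ^ k\<close>
      or is zero; its diagonal entry excludes zero.\<close>
    have col: "?W *\<^sub>v unit_vec ?n j = col ?W j"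
      using W j by (intro eq_vecI) auto
    have "col ?W j $ j = 1" using W j diag by simp
    then have "col ?W j \<noteq> 0\<^sub>v ?n" using j by auto
    then show ?thesis
      using weight_simplex_mat_mult_vec[of "unit_vec ?n j" k] col by simp
  qed
  then show ?thesis using W diag by (simp add: A_star_def A_def)
qed

lemma max_weight_simplex_mat: "max_weight (simplex_mat (k + 1)) \<le> 2 ^ k"
proof (rule max_weight_leI)
  fix x :: "bit vec"
  assume "x \<in> carrier_vec (dim_col (simplex_mat (k + 1)))"
  then have "x \<in> carrier_vec (2 ^ (k + 1) - 1)" by (simp add: simplex_mat_def)
  from weight_simplex_mat_mult_vec[OF this]
  show "weight (simplex_mat (k + 1) *\<^sub>v x) \<le> 2 ^ k"
  proof
    assume "simplex_mat (k + 1) *\<^sub>v x = 0\<^sub>v (2 ^ (k + 1) - 1)"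
    then show ?thesis by (simp only:) (simp add: weight_def cong: conj_cong)
  qed simp
qed

theorem theorem3p3:
  fixes k m :: nat
  assumes "m \<ge> 2 ^ k"
  shows "mu (2 ^ (k + 1) - 1) m = mu_star (2 ^ (k + 1) - 1) (2 ^ k)
    \<and> mu_star (2 ^ (k + 1) - 1) (2 ^ k) = 2 ^ k"
proof -
  let ?n = "2 ^ (k + 1) - 1 :: nat" and ?W = "simplex_mat (k + 1)"
  \<comment> \<open>Integrality rounds \<open>(2 ^ (k + 1) - 1) / 2\<close> up to
    \<open>2 ^ k\<close>.\<close>
  have lower: "2 ^ k \<le> max_weight W" if "W \<in> A ?n l" for W l
  proof -
    have "?n \<le> 2 * max_weight W"
      by (rule dim_le_twice_max_weight) (use that in \<open>auto simp: A_def\<close>)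
    then show ?thesis by simp
  qed
  \<comment> \<open>One statement covers both minima: \<open>S\<close> will be the whole of
    \<open>A ?n m\<close>, then \<open>A_star ?n (2 ^ k)\<close>.\<close>
  have Min_eq: "Min (max_weight ` S) = 2 ^ k" if S: "S \<subseteq> A ?n l" and W: "?W \<in> S" for S l
  proof (rule Min_eqI)
    show "finite (max_weight ` S)"
      by (rule finite_subset[OF image_mono[OF S] finite_max_weight_A])
    show "2 ^ k \<le> w" if "w \<in> max_weight ` S" for w
      using that lower S by auto
    have "max_weight ?W = 2 ^ k"
      by (rule antisym[OF max_weight_simplex_mat lower[OF subsetD[OF S W]]])
    then show "2 ^ k \<in> max_weight ` S"
      by (rule image_eqI[OF sym W])
  qed
  \<comment> \<open>The columns have weight \<open>2 ^ k\<close>, so \<open>m \<ge> 2 ^ k\<close>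
    admits the simplex matrix.\<close>
  have "?W \<in> A ?n m"
    using simplex_mat_in_A_star[of k] assms by (auto simp: A_star_def A_def)
  then have "mu ?n m = 2 ^ k"
    unfolding mu_def by (intro Min_eq) auto
  moreover have "mu_star ?n (2 ^ k) = 2 ^ k"
    unfolding mu_star_def
    by (rule Min_eq[OF _ simplex_mat_in_A_star]) (auto simp: A_star_def)
  ultimately show ?thesis by simp
qed

end
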